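(* Let $n\ge 0$ be an integer. Hanna $n$-matrices, Hanna $n$-deals and Hanna $n$-paths are equinumerous. More specifically: (a) The following map is a bijection from Hanna $n$-matrices to Hanna $n$-paths: transform the columns in turn, from left to right, into labeled steps (subscripts denote step labels) by $$\left(\begin{smallmatrix}1\\1\end{smallmatrix}\right)\mapsto F_1,\ \left(\begin{smallmatrix}1\\2\end{smallmatrix}\right)\mapsto U_1,\ \left(\begin{smallmatrix}1\\3\end{smallmatrix}\right)\mapsto U_2,\ \left(\begin{smallmatrix}2\\1\end{smallmatrix}\right)\mapsto D_1,\ \left(\begin{smallmatrix}2\\2\end{smallmatrix}\right)\mapsto F_2,\ \left(\begin{smallmatrix}2\\3\end{smallmatrix}\right)\mapsto F_3,\ \left(\begin{smallmatrix}3\\1\end{smallmatrix}\right)\mapsto D_2,\ \left(\begin{smallmatrix}3\\2\end{smallmatrix}\right)\mapsto F_4,\ \left(\begin{smallmatrix}3\\3\end{smallmatrix}\right)\mapsto F_5.$$ (b) The following correspondence is a bijection between Hanna $n$-deals and Hanna $n$-matrices: for each denomination $d\in\{1,\dots,n\}$, the $d$-th column of the matrix is - $\left(\begin{smallmatrix}1\\1\end{smallmatrix}\right)$ if $d$ is not in the deal; - $\left(\begin{smallmatrix}1\\2\end{smallmatrix}\right)$ if $d$ is in the deal, does not occur in red's hand, and the red card of denomination $d$ is not in blue's hand; - $\left(\begin{smallmatrix}1\\3\end{smallmatrix}\right)$ if $d$ does not occur in red's hand but the red card of denomination $d$ is in blue's hand; - $\left(\begin{smallmatrix}2\\1\end{smallmatrix}\right)$,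 $\left(\begin{smallmatrix}2\\2\end{smallmatrix}\right)$, $\left(\begin{smallmatrix}2\\3\end{smallmatrix}\right)$ if the red card of denomination $d$ is in blue's hand and $d$ occurs in red's hand on both the green and blue cards, on the green card only, on the blue card only, respectively; - $\left(\begin{smallmatrix}3\\1\end{smallmatrix}\right)$, $\left(\begin{smallmatrix}3\\2\end{smallmatrix}\right)$, $\left(\begin{smallmatrix}3\\3\end{smallmatrix}\right)$ if the red card of denomination $d$ is not in blue's hand and $d$ occurs in red's hand on both the green and blue cards, on the green card only, on the blue card only, respectively.
   Context: A Delannoy path is a lattice path of upsteps $U=(1,1)$, downsteps $D=(1,-1)$ and flatsteps $F=(1,0)$ with an equal number of $U$s and $D$s (it may go below its starting level). A Hanna $n$-path is a Delannoy path with $n$ steps in total, each labeled: each slanted step ($U$ or $D$) gets one of the two labels $1,2$, and each flatstep gets one of the five labels $1,2,3,4,5$. A Hanna $n$-deal is formed as follows. Start with a deck of $3n$ cards, $n$ each colored red, green and blue, with one card of each color in each denomination $1,\dots,n$. Choose an arbitrary subset of the denominations (the denominations "in the deal") and deal all cards of the chosen denominations to three players designated red, green and blue, in such a way that no player receives a card of her own color and, if there are $j$ denominations in the deal, red's hand contains exactly $j$ cards (the remaining $2j$ cards are split arbitrarily between the green and blue players, subject to no player receiving a card of her own color). A deal is determined by the set of cards in each hand. A Hanna $n$-matrix is a $2\times n$ matrix with entries in $\{1,2,3\}$ and the same number of $1$s in each row. Columns are written with the top-row entry above the bottom-row entry. *)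

theory Defs
  imports Main "HOL-Library.Equipollence" "Jordan_Normal_Form.Matrix"
begin

abbreviation upstep :: "int \<times> int" where "upstep \<equiv> (1, 1)"
abbreviation downstep :: "int \<times> int" where "downstep \<equiv> (1, -1)"
abbreviation flatstep :: "int \<times> int" where "flatstep \<equiv> (1, 0)"

definition delannoy_path :: "(int \<times> int) list \<Rightarrow> bool" where
  "delannoy_path p \<longleftrightarrow>
     set p \<subseteq> {upstep, downstep, flatstep} \<and> count_list p upstep = count_list p downstep"

definition step_labels :: "int \<times> int \<Rightarrow> nat set" where
  "step_labels s = (if s = flatstep then {1, 2, 3, 4, 5} else {1, 2})"

definition hanna_paths :: "nat \<Rightarrow> ((int \<times> int) \<times> nat) list set" where
  "hanna_paths n =
     {p. length p = n \<and> delannoy_path (map fst p) \<and> (\<forall>(s, l) \<in> set p. l \<in> step_labels s)}"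

definition hanna_matrices :: "nat \<Rightarrow> nat mat set" where
  "hanna_matrices n =
     {A \<in> carrier_mat 2 n. elements_mat A \<subseteq> {1, 2, 3} \<and>
        card {j. j < n \<and> A $$ (0, j) = 1} = card {j. j < n \<and> A $$ (1, j) = 1}}"

text \<open>The three players are named by the colors.  A card is a pair of a color and a
  denomination, and a deal is given by the three hands.\<close>

datatype color = Red | Green | Blue

type_synonym deal = "color \<Rightarrow> (color \<times> nat) set"

text \<open>The set \<open>S\<close> below consists of the denominations in the deal; the hands determine it.\<close>

definition hanna_deals :: "nat \<Rightarrow> deal set" where
  "hanna_deals n =
     {H. \<exists>S \<subseteq> {1..n}.
        (\<Union>p. H p) = UNIV \<times> S \<and>
        (\<forall>p q. p \<noteq> q \<longrightarrow> H p \<inter> H q = {}) \<and>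
        (\<forall>p d. (p, d) \<notin> H p) \<and>
        card (H Red) = card S}"

definition in_deal :: "deal \<Rightarrow> nat \<Rightarrow> bool" where
  "in_deal H d \<longleftrightarrow> (\<exists>p c. (c, d) \<in> H p)"

definition in_red_hand :: "deal \<Rightarrow> nat \<Rightarrow> bool" where
  "in_red_hand H d \<longleftrightarrow> (\<exists>c. (c, d) \<in> H Red)"

text \<open>In both case distinctions below, the final \<open>undefined\<close> is never reached on a Hanna
  matrix or a Hanna deal.  Columns are written as pairs (top entry, bottom entry).\<close>

definition column_step :: "nat \<times> nat \<Rightarrow> (int \<times> int) \<times> nat" where
  "column_step c =
     (if c = (1, 1) then (flatstep, 1)
      else if c = (1, 2) then (upstep, 1)
      else if c = (1, 3) then (upstep, 2)
      else if c = (2, 1) then (downstep, 1)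
      else if c = (2, 2) then (flatstep, 2)
      else if c = (2, 3) then (flatstep, 3)
      else if c = (3, 1) then (downstep, 2)
      else if c = (3, 2) then (flatstep, 4)
      else if c = (3, 3) then (flatstep, 5)
      else undefined)"

definition matrix_to_path :: "nat mat \<Rightarrow> ((int \<times> int) \<times> nat) list" where
  "matrix_to_path A = map (\<lambda>j. column_step (A $$ (0, j), A $$ (1, j))) [0..<dim_col A]"

definition deal_column :: "deal \<Rightarrow> nat \<Rightarrow> nat \<times> nat" where
  "deal_column H d =
     (let red_to_blue = ((Red, d) \<in> H Blue);
          green_to_red = ((Green, d) \<in> H Red);
          blue_to_red = ((Blue, d) \<in> H Red)
      in if \<not> in_deal H d then (1, 1)
         else if \<not> in_red_hand H d \<and> \<not> red_to_blue then (1, 2)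
         else if \<not> in_red_hand H d \<and> red_to_blue then (1, 3)
         else if red_to_blue \<and> green_to_red \<and> blue_to_red then (2, 1)
         else if red_to_blue \<and> green_to_red \<and> \<not> blue_to_red then (2, 2)
         else if red_to_blue \<and> \<not> green_to_red \<and> blue_to_red then (2, 3)
         else if \<not> red_to_blue \<and> green_to_red \<and> blue_to_red then (3, 1)
         else if \<not> red_to_blue \<and> green_to_red \<and> \<not> blue_to_red then (3, 2)
         else if \<not> red_to_blue \<and> \<not> green_to_red \<and> blue_to_red then (3, 3)
         else undefined)"

text \<open>Matrix indices start at 0, denominations at 1.\<close>

definition deal_to_matrix :: "nat \<Rightarrow> deal \<Rightarrow> nat mat" where
  "deal_to_matrix n H =
     mat 2 n (\<lambda>(i, j). if i = 0 then fst (deal_column H (j + 1)) else snd (deal_column H (j + 1)))"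

end

theory Submission imports Defs
begin

text \<open>
  Both bijections act column by column, so each rests on a nine-element bijection:
  \<open>{1, 2, 3} \<times> {1, 2, 3}\<close> corresponds to the nine labeled steps
  (\<open>column_step_bij\<close>), and also to the nine things that can happen to a single
  denomination, namely not being dealt, or one of the \<open>2 * 2 * 2\<close> ways to give each of its
  three cards to one of the two players of another color (\<open>share_deal_column\<close>,
  \<open>deal_column_share\<close>).

  What remains is that the three global conditions agree.  They all say that as many columns
  have their only \<open>1\<close> on top as have their only \<open>1\<close> at the bottom: columns with two \<open>1\<close>s
  contribute equally to both rows (\<open>card_eq_iff_card_Diff_eq\<close>).  Under the first
  correspondence these columns are the upsteps and the downsteps.  Under the second they are the
  dealt denominations of which red receives no card, respectively two cards; since red receives
  one card of every other dealt denomination, her hand has as many cards as there are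
  denominations in the deal exactly when these two numbers agree
  (\<open>card_red_hand_iff\<close>).
\<close>

lemma card_eq_iff_card_Diff_eq:
  assumes "finite A" "finite B"
  shows "card A = card B \<longleftrightarrow> card (A - B) = card (B - A)"
proof -
  have "card A = card (A - B) + card (A \<inter> B)" "card B = card (B - A) + card (A \<inter> B)"
    using assms card_Diff_subset_Int[of A B] card_Diff_subset_Int[of B A]
      card_mono[of A "A \<inter> B"] card_mono[of B "A \<inter> B"] by (auto simp: Int_commute)
  then show ?thesis by simp
qed

section \<open>Hanna matrices by columns\<close>

abbreviation columns :: "(nat \<times> nat) set" where
  "columns \<equiv> {1, 2, 3} \<times> {1, 2, 3}"

abbreviation mat_column :: "nat mat \<Rightarrow> nat \<Rightarrow> nat \<times> nat" where
  "mat_column A j \<equiv> (A $$ (0, j), A $$ (1, j))"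

definition mat_of_columns :: "nat \<Rightarrow> (nat \<Rightarrow> nat \<times> nat) \<Rightarrow> nat mat" where
  "mat_of_columns n f = mat 2 n (\<lambda>(i, j). if i = 0 then fst (f j) else snd (f j))"

lemma dim_mat_of_columns [simp]:
  "dim_row (mat_of_columns n f) = 2" "dim_col (mat_of_columns n f) = n"
  by (simp_all add: mat_of_columns_def)

lemma mat_column_mat_of_columns [simp]:
  "j < n \<Longrightarrow> mat_column (mat_of_columns n f) j = f j"
  by (simp add: mat_of_columns_def)

lemma mat_of_columns_eqI:
  assumes "A \<in> carrier_mat 2 n" and "\<And>j. j < n \<Longrightarrow> f j = mat_column A j"
  shows "mat_of_columns n f = A"
  using assms by (intro eq_matI) (auto simp: mat_of_columns_def less_2_cases_iff)

text \<open>Columns with two \<open>1\<close>s cancel from the balance condition, which leaves the columns that become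
  slanted steps.\<close>

lemma hanna_matrices_iff:
  "A \<in> hanna_matrices n \<longleftrightarrow>
     A \<in> carrier_mat 2 n \<and> (\<forall>j<n. mat_column A j \<in> columns) \<and>
     card {j. j < n \<and> fst (mat_column A j) = 1 \<and> snd (mat_column A j) \<noteq> 1} =
     card {j. j < n \<and> fst (mat_column A j) \<noteq> 1 \<and> snd (mat_column A j) = 1}"
proof -
  have entries: "elements_mat A \<subseteq> {1, 2, 3} \<longleftrightarrow> (\<forall>j<n. mat_column A j \<in> columns)"
    if "A \<in> carrier_mat 2 n"
  proof -
    have "elements_mat A = {A $$ (i, j) |i j. i < 2 \<and> j < n}"
      using that unfolding elements_mat_def by fastforce
    then have "elements_mat A \<subseteq> E \<longleftrightarrow> (\<forall>j<n. \<forall>i<2. A $$ (i, j) \<in> E)" for E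
      by auto
    moreover have "(\<forall>i<2. P i) \<longleftrightarrow> P 0 \<and> P 1" for P :: "nat \<Rightarrow> bool"
      by (auto simp: less_2_cases_iff)
    ultimately show ?thesis
      by (simp only: mem_Times_iff fst_conv snd_conv)
  qed
  have ones: "card {j. j < n \<and> A $$ (0, j) = 1} = card {j. j < n \<and> A $$ (1, j) = 1} \<longleftrightarrow>
     card {j. j < n \<and> A $$ (0, j) = 1 \<and> A $$ (1, j) \<noteq> 1} =
     card {j. j < n \<and> A $$ (0, j) \<noteq> 1 \<and> A $$ (1, j) = 1}"
    by (subst card_eq_iff_card_Diff_eq)
       (auto intro!: arg_cong2[where f = "(=)"] arg_cong[where f = card])
  show ?thesis
    by (simp only: hanna_matrices_def mem_Collect_eq fst_conv snd_conv ones entries cong: conj_cong)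
qed

section \<open>Matrices and paths\<close>

definition labeled_steps :: "((int \<times> int) \<times> nat) set" where
  "labeled_steps = {(s, l). s \<in> {upstep, downstep, flatstep} \<and> l \<in> step_labels s}"

lemma column_step_bij: "bij_betw column_step columns labeled_steps"
proof (rule bij_betw_imageI)
  have columns: "columns = {(1, 1), (1, 2), (1, 3), (2, 1), (2, 2), (2, 3), (3, 1), (3, 2), (3, 3)}"
    by (simp add: insert_Times_insert)
  then have "card (column_step ` columns) = card columns"
    by (simp add: column_step_def)
  then show "inj_on column_step columns"
    by (intro eq_card_imp_inj_on) auto
  have "labeled_steps = (\<Union>s\<in>{upstep, downstep, flatstep}. Pair s ` step_labels s)"
    unfolding labeled_steps_def by blast
  then have "labeled_steps =
      Pair upstep ` {1, 2} \<union> (Pair downstep ` {1, 2} \<union> Pair flatstep ` {1, 2, 3, 4, 5})"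
    by (simp add: step_labels_def)
  with columns show "column_step ` columns = labeled_steps"
    by (simp add: column_step_def) blast
qed

lemma column_step_slanted_iff:
  assumes "c \<in> columns"
  shows "fst (column_step c) = upstep \<longleftrightarrow> fst c = 1 \<and> snd c \<noteq> 1"
    and "fst (column_step c) = downstep \<longleftrightarrow> fst c \<noteq> 1 \<and> snd c = 1"
  using assms by (auto simp: column_step_def)

lemma hanna_paths_iff:
  "p \<in> hanna_paths n \<longleftrightarrow>
     length p = n \<and> (\<forall>j<n. p ! j \<in> labeled_steps) \<and>
     card {j. j < n \<and> fst (p ! j) = upstep} = card {j. j < n \<and> fst (p ! j) = downstep}"
proof -
  have counts: "count_list (map fst p) s = card {j. j < length p \<and> fst (p ! j) = s}" for s
    unfolding count_list_eq_length_filter length_filter_conv_card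
    by (auto intro!: arg_cong[where f = card])
  have "set p \<subseteq> labeled_steps \<longleftrightarrow>
      set (map fst p) \<subseteq> {upstep, downstep, flatstep} \<and> (\<forall>(s, l) \<in> set p. l \<in> step_labels s)"
    by (simp only: labeled_steps_def set_map image_subset_iff split_def subset_eq[of "set p"]
        mem_Collect_eq ball_conj_distrib)
  moreover have "set p \<subseteq> labeled_steps \<longleftrightarrow> (\<forall>j<length p. p ! j \<in> labeled_steps)"
    by (auto simp: set_conv_nth)
  ultimately have steps: "set (map fst p) \<subseteq> {upstep, downstep, flatstep} \<and>
        (\<forall>(s, l) \<in> set p. l \<in> step_labels s) \<longleftrightarrow> (\<forall>j<length p. p ! j \<in> labeled_steps)"
    by (rule trans[OF sym])
  show ?thesis
  proof (cases "length p = n")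
    case True
    show ?thesis
      unfolding hanna_paths_def delannoy_path_def mem_Collect_eq counts True
      using steps[unfolded True] by argo
  qed (simp add: hanna_paths_def)
qed

text \<open>The balance conditions are equivalent, which is stronger than the map preserving balance; the
  converse shows that the inverse map also lands in the right set.\<close>

lemma matrix_to_path_in_hanna_paths_iff:
  assumes "A \<in> carrier_mat 2 n" and "\<forall>j<n. mat_column A j \<in> columns"
  shows "matrix_to_path A \<in> hanna_paths n \<longleftrightarrow> A \<in> hanna_matrices n"
proof -
  have nth: "length (matrix_to_path A) = n"
      "\<And>j. j < n \<Longrightarrow> matrix_to_path A ! j = column_step (mat_column A j)"
    using assms(1) by (auto simp: matrix_to_path_def)
  have slanted: "{j. j < n \<and> fst (matrix_to_path A ! j) = upstep} =
        {j. j < n \<and> fst (mat_column A j) = 1 \<and> snd (mat_column A j) \<noteq> 1}"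
      "{j. j < n \<and> fst (matrix_to_path A ! j) = downstep} =
        {j. j < n \<and> fst (mat_column A j) \<noteq> 1 \<and> snd (mat_column A j) = 1}"
    by (intro Collect_cong conj_cong refl;
        simp only: nth(2) column_step_slanted_iff[OF assms(2)[rule_format]])+
  have "\<forall>j<n. matrix_to_path A ! j \<in> labeled_steps"
    using assms(2) nth(2) bij_betwE[OF column_step_bij] by metis
  then show ?thesis
    unfolding hanna_paths_iff hanna_matrices_iff slanted using assms nth(1) by blast
qed

lemma matrix_to_path_bij: "bij_betw matrix_to_path (hanna_matrices n) (hanna_paths n)"
proof -
  define step_column where "step_column = inv_into columns column_step"
  define path_to_matrix where "path_to_matrix p = mat_of_columns n (\<lambda>j. step_column (p ! j))" for p
  have step_column: "step_column s \<in> columns" "column_step (step_column s) = s"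
    if "s \<in> labeled_steps" for s
    using that bij_betwE[OF bij_betw_inv_into[OF column_step_bij]]
      bij_betw_inv_into_right[OF column_step_bij] unfolding step_column_def by blast+
  have column_step: "step_column (column_step c) = c" if "c \<in> columns" for c
    using that bij_betw_inv_into_left[OF column_step_bij] unfolding step_column_def by blast
  have path: "matrix_to_path (path_to_matrix p) = p" "path_to_matrix p \<in> hanna_matrices n"
    if "p \<in> hanna_paths n" for p
  proof -
    have steps: "length p = n" "\<forall>j<n. p ! j \<in> labeled_steps"
      using that by (simp_all add: hanna_paths_iff)
    show eq: "matrix_to_path (path_to_matrix p) = p"
      unfolding matrix_to_path_def path_to_matrix_def
      using steps by (intro nth_equalityI) (simp_all add: step_column(2) del: One_nat_def)
    have cols: "\<forall>j<n. mat_column (path_to_matrix p) j \<in> columns"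
      using steps(2) step_column(1) unfolding path_to_matrix_def
      by (intro allI impI) (simp only: mat_column_mat_of_columns)
    have "path_to_matrix p \<in> carrier_mat 2 n"
      unfolding path_to_matrix_def by (intro carrier_matI dim_mat_of_columns)
    from matrix_to_path_in_hanna_paths_iff[OF this cols] show "path_to_matrix p \<in> hanna_matrices n"
      unfolding eq using that by (rule iffD1)
  qed
  have "path_to_matrix (matrix_to_path A) = A" if A: "A \<in> hanna_matrices n" for A
    unfolding path_to_matrix_def
  proof (rule mat_of_columns_eqI)
    show carrier: "A \<in> carrier_mat 2 n" using A by (simp add: hanna_matrices_iff)
    fix j assume j: "j < n"
    have "mat_column A j \<in> columns"
      using A j unfolding hanna_matrices_iff by blast
    then show "step_column (matrix_to_path A ! j) = mat_column A j"
      using carrier j column_step by (simp add: matrix_to_path_def)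
  qed
  moreover have "matrix_to_path A \<in> hanna_paths n" if "A \<in> hanna_matrices n" for A
    using that matrix_to_path_in_hanna_paths_iff[of A n] unfolding hanna_matrices_iff by blast
  ultimately show ?thesis
    using path by (intro bij_betw_byWitness[where f' = path_to_matrix]) auto
qed

section \<open>Deals of a single denomination\<close>

text \<open>The size of red's hand links the denominations of a deal.  The other conditions
  concern each denomination separately; they are split off here.\<close>

definition color_avoiding :: "nat set \<Rightarrow> deal \<Rightarrow> bool" where
  "color_avoiding S H \<longleftrightarrow>
     (\<Union>p. H p) = UNIV \<times> S \<and> (\<forall>p q. p \<noteq> q \<longrightarrow> H p \<inter> H q = {}) \<and> (\<forall>p d. (p, d) \<notin> H p)"

lemma hanna_deals_iff:
  "H \<in> hanna_deals n \<longleftrightarrow> (\<exists>S \<subseteq> {1..n}. color_avoiding S H \<and> card (H Red) = card S)"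
  unfolding hanna_deals_def color_avoiding_def by blast

text \<open>The inverse of \<open>deal_column\<close>: the cards of a denomination that each player
  receives when its column is given.  A top entry \<open>1\<close> means that red receives none, and the bottom
  entry then says whether the denomination is dealt and where the red card goes.  Otherwise the top
  entry says where the red card goes, and the bottom entry which cards red receives.\<close>

definition red_share :: "nat \<times> nat \<Rightarrow> color set" where
  "red_share c =
     (if fst c = 1 then {}
      else if snd c = 1 then {Green, Blue} else if snd c = 2 then {Green} else {Blue})"

fun share :: "nat \<times> nat \<Rightarrow> color \<Rightarrow> color set" where
  "share c Red = red_share c"
| "share c Blue =
     (if c = (1, 1) then {}
      else (if fst c = 2 \<or> c = (1, 3) then {Red} else {}) \<union> ({Green} - red_share c))"
| "share c Green =
     (if c = (1, 1) then {}
      else (if fst c = 2 \<or> c = (1, 3) then {} else {Red}) \<union> ({Blue} - red_share c))"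

lemma ex_color: "(\<exists>c. P c) \<longleftrightarrow> P Red \<or> P Green \<or> P Blue"
  by (metis color.exhaust)

text \<open>Within a dealt denomination the whole deal is known from three bits, since each card has
  only two possible owners.\<close>

lemma color_avoiding_cases:
  assumes "color_avoiding S H"
  shows "(Red, d) \<notin> H Red" "(Green, d) \<notin> H Green" "(Blue, d) \<notin> H Blue"
    and "(Red, d) \<in> H Green \<longleftrightarrow> d \<in> S \<and> (Red, d) \<notin> H Blue"
    and "(Green, d) \<in> H Blue \<longleftrightarrow> d \<in> S \<and> (Green, d) \<notin> H Red"
    and "(Blue, d) \<in> H Green \<longleftrightarrow> d \<in> S \<and> (Blue, d) \<notin> H Red"
    and "(c, d) \<in> H p \<Longrightarrow> d \<in> S"
    and "in_deal H d \<longleftrightarrow> d \<in> S"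
    and "in_red_hand H d \<longleftrightarrow> (Green, d) \<in> H Red \<or> (Blue, d) \<in> H Red"
proof -
  have cover: "(\<exists>p. (c, d) \<in> H p) \<longleftrightarrow> d \<in> S" for c
    using assms unfolding color_avoiding_def by auto
  have disjoint: "(c, d) \<in> H p \<Longrightarrow> (c, d) \<in> H q \<Longrightarrow> p = q" for c p q
    using assms unfolding color_avoiding_def by blast
  show own: "(Red, d) \<notin> H Red" "(Green, d) \<notin> H Green" "(Blue, d) \<notin> H Blue"
    using assms unfolding color_avoiding_def by auto
  show "(Red, d) \<in> H Green \<longleftrightarrow> d \<in> S \<and> (Red, d) \<notin> H Blue"
    using own cover[of Red] disjoint[of Red Green Blue] by (auto simp: ex_color)
  show "(Green, d) \<in> H Blue \<longleftrightarrow> d \<in> S \<and> (Green, d) \<notin> H Red"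
    using own cover[of Green] disjoint[of Green Red Blue] by (auto simp: ex_color)
  show "(Blue, d) \<in> H Green \<longleftrightarrow> d \<in> S \<and> (Blue, d) \<notin> H Red"
    using own cover[of Blue] disjoint[of Blue Green Red] by (auto simp: ex_color)
  show "(c, d) \<in> H p \<Longrightarrow> d \<in> S"
    using cover by blast
  show "in_deal H d \<longleftrightarrow> d \<in> S"
    using cover unfolding in_deal_def by blast
  show "in_red_hand H d \<longleftrightarrow> (Green, d) \<in> H Red \<or> (Blue, d) \<in> H Red"
    using own unfolding in_red_hand_def by (auto simp: ex_color)
qed

lemma deal_column_props:
  assumes "color_avoiding S H"
  shows "deal_column H d \<in> columns"
    and "fst (deal_column H d) = 1 \<and> snd (deal_column H d) \<noteq> 1 \<longleftrightarrow>
         d \<in> S \<and> (Green, d) \<notin> H Red \<and> (Blue, d) \<notin> H Red"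
    and "fst (deal_column H d) \<noteq> 1 \<and> snd (deal_column H d) = 1 \<longleftrightarrow>
         (Green, d) \<in> H Red \<and> (Blue, d) \<in> H Red"
  using color_avoiding_cases[OF assms, where d = d]
  by (auto simp: deal_column_def Let_def)

lemma share_deal_column:
  assumes "color_avoiding S H"
  shows "c \<in> share (deal_column H d) p \<longleftrightarrow> (c, d) \<in> H p"
  using color_avoiding_cases[OF assms, where d = d]
  by (cases p; cases c) (auto simp: deal_column_def red_share_def Let_def)

lemma deal_column_share:
  assumes "c \<in> columns" and "\<And>e p. (e, d) \<in> H p \<longleftrightarrow> e \<in> share c p"
  shows "deal_column H d = c"
  using assms(1)
  by (auto simp: deal_column_def in_deal_def in_red_hand_def Let_def assms(2) ex_color red_share_def)

section \<open>Deals and matrices\<close>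

text \<open>If red receives the green cards of the denominations in \<open>G\<close> and the blue ones of those in
  \<open>B\<close>, then \<open>card (H Red) = card (G \<union> B) + card (G \<inter> B)\<close>, and \<open>card (G \<union> B)\<close> falls short of
  \<open>card S\<close> by the number of dealt denominations that red misses.\<close>

lemma card_red_hand_iff:
  assumes "color_avoiding S H" and "finite S"
  shows "card (H Red) = card S \<longleftrightarrow>
    card {d \<in> S. (Green, d) \<notin> H Red \<and> (Blue, d) \<notin> H Red} =
    card {d. (Green, d) \<in> H Red \<and> (Blue, d) \<in> H Red}"
proof -
  define G where "G = {d. (Green, d) \<in> H Red}"
  define B where "B = {d. (Blue, d) \<in> H Red}"
  have sub: "G \<subseteq> S" "B \<subseteq> S"
    unfolding G_def B_def using color_avoiding_cases(7)[OF assms(1)] by auto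
  then have fin: "finite G" "finite B"
    using assms(2) finite_subset by auto
  have "(c, d) \<in> H Red \<longleftrightarrow> c = Green \<and> d \<in> G \<or> c = Blue \<and> d \<in> B" for c d
    using color_avoiding_cases(1)[OF assms(1)] by (cases c) (auto simp: G_def B_def)
  then have "H Red = {Green} \<times> G \<union> {Blue} \<times> B"
    by auto
  then have "card (H Red) = card ({Green} \<times> G) + card ({Blue} \<times> B)"
    using fin by (simp only:, intro card_Un_disjoint) auto
  also have "\<dots> = card G + card B"
    by (simp add: card_cartesian_product)
  also have "\<dots> = card (G \<union> B) + card (G \<inter> B)"
    by (rule card_Un_Int[OF fin])
  finally have "card (H Red) = card (G \<union> B) + card (G \<inter> B)" .
  moreover have "card S = card (G \<union> B) + card (S - (G \<union> B))"
    using sub fin assms(2) by (metis Un_least card_Diff_subset card_mono finite_Un le_add_diff_inverse)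
  moreover have "S - (G \<union> B) = {d \<in> S. (Green, d) \<notin> H Red \<and> (Blue, d) \<notin> H Red}"
      "G \<inter> B = {d. (Green, d) \<in> H Red \<and> (Blue, d) \<in> H Red}"
    by (auto simp: G_def B_def)
  ultimately show ?thesis by auto
qed

lemma deal_to_matrix_conv: "deal_to_matrix n H = mat_of_columns n (\<lambda>j. deal_column H (Suc j))"
  unfolding deal_to_matrix_def mat_of_columns_def Suc_eq_plus1 ..

lemma card_Suc_shift:
  assumes "{d. P d} \<subseteq> {1..n}"
  shows "card {j. j < n \<and> P (Suc j)} = card {d. P d}"
proof -
  have "{d. P d} = Suc ` {j. j < n \<and> P (Suc j)}"
  proof (intro equalityI subsetI)
    fix d assume "d \<in> {d. P d}"
    moreover from this obtain j where "d = Suc j" "j < n"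
      using assms by (cases d) auto
    ultimately show "d \<in> Suc ` {j. j < n \<and> P (Suc j)}" by auto
  qed auto
  then show ?thesis by (simp add: card_image)
qed

text \<open>Again an equivalence, so that it serves both the map and its inverse.\<close>

lemma deal_to_matrix_in_hanna_matrices_iff:
  assumes H: "color_avoiding S H" and S: "S \<subseteq> {1..n}"
  shows "deal_to_matrix n H \<in> hanna_matrices n \<longleftrightarrow> card (H Red) = card S"
proof -
  let ?A = "deal_to_matrix n H"
  have column: "mat_column ?A j = deal_column H (Suc j)" if "j < n" for j
    using that unfolding deal_to_matrix_conv by (rule mat_column_mat_of_columns)
  have "card {j. j < n \<and> fst (mat_column ?A j) = 1 \<and> snd (mat_column ?A j) \<noteq> 1} =
      card {j. j < n \<and> Suc j \<in> S \<and> (Green, Suc j) \<notin> H Red \<and> (Blue, Suc j) \<notin> H Red}"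
    by (intro arg_cong[where f = card] Collect_cong conj_cong[OF refl])
       (simp only: column deal_column_props(2)[OF H])
  also have "\<dots> = card {d \<in> S. (Green, d) \<notin> H Red \<and> (Blue, d) \<notin> H Red}"
    using S by (intro card_Suc_shift) auto
  finally have none: "card {j. j < n \<and> fst (mat_column ?A j) = 1 \<and> snd (mat_column ?A j) \<noteq> 1} =
      card {d \<in> S. (Green, d) \<notin> H Red \<and> (Blue, d) \<notin> H Red}" .
  have "card {j. j < n \<and> fst (mat_column ?A j) \<noteq> 1 \<and> snd (mat_column ?A j) = 1} =
      card {j. j < n \<and> (Green, Suc j) \<in> H Red \<and> (Blue, Suc j) \<in> H Red}"
    by (intro arg_cong[where f = card] Collect_cong conj_cong[OF refl])
       (simp only: column deal_column_props(3)[OF H])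
  also have "\<dots> = card {d. (Green, d) \<in> H Red \<and> (Blue, d) \<in> H Red}"
    using S color_avoiding_cases(7)[OF H] by (intro card_Suc_shift) blast
  finally have both: "card {j. j < n \<and> fst (mat_column ?A j) \<noteq> 1 \<and> snd (mat_column ?A j) = 1} =
      card {d. (Green, d) \<in> H Red \<and> (Blue, d) \<in> H Red}" .
  have "\<forall>j<n. mat_column ?A j \<in> columns"
    using column deal_column_props(1)[OF H] by metis
  moreover have "?A \<in> carrier_mat 2 n"
    by (simp add: deal_to_matrix_def)
  ultimately show ?thesis
    unfolding hanna_matrices_iff none both
    using card_red_hand_iff[OF H finite_subset[OF S]] by simp
qed

definition matrix_to_deal :: "nat \<Rightarrow> nat mat \<Rightarrow> deal" where
  "matrix_to_deal n A p = {(c, d). d \<in> {1..n} \<and> c \<in> share (mat_column A (d - 1)) p}"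

lemma color_avoiding_matrix_to_deal:
  assumes "\<forall>j<n. mat_column A j \<in> columns"
  shows "color_avoiding {d \<in> {1..n}. mat_column A (d - 1) \<noteq> (1, 1)} (matrix_to_deal n A)"
proof -
  have cover: "(\<exists>p. c \<in> share x p) \<longleftrightarrow> x \<noteq> (1, 1)" if "x \<in> columns" for c x
    using that by (cases c) (auto simp: ex_color red_share_def)
  have disjoint: "share x p \<inter> share x q = {}" if "p \<noteq> q" for x p q
    using that by (cases p; cases q) (auto simp: red_share_def)
  have own: "p \<notin> share x p" for x p
    by (cases p) (auto simp: red_share_def)
  have column: "mat_column A (d - 1) \<in> columns" if "d \<in> {1..n}" for d
  proof -
    have "d - 1 < n" using that by auto
    then show ?thesis using assms by blast
  qed
  have "(\<Union>p. matrix_to_deal n A p) = UNIV \<times> {d \<in> {1..n}. mat_column A (d - 1) \<noteq> (1, 1)}"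
    using cover[OF column] unfolding matrix_to_deal_def by blast
  moreover have "matrix_to_deal n A p \<inter> matrix_to_deal n A q = {}" if "p \<noteq> q" for p q
    using disjoint[OF that] unfolding matrix_to_deal_def by blast
  moreover have "(p, d) \<notin> matrix_to_deal n A p" for p d
    using own unfolding matrix_to_deal_def by blast
  ultimately show ?thesis
    unfolding color_avoiding_def by blast
qed

lemma deal_to_matrix_bij: "bij_betw (deal_to_matrix n) (hanna_deals n) (hanna_matrices n)"
proof -
  have matrix: "deal_to_matrix n (matrix_to_deal n A) = A" "matrix_to_deal n A \<in> hanna_deals n"
    if "A \<in> hanna_matrices n" for A
  proof -
    have A: "A \<in> carrier_mat 2 n" "\<forall>j<n. mat_column A j \<in> columns"
      using that unfolding hanna_matrices_iff by blast+
    show eq: "deal_to_matrix n (matrix_to_deal n A) = A"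
      unfolding deal_to_matrix_conv
    proof (rule mat_of_columns_eqI[OF A(1)])
      fix j assume j: "j < n"
      show "deal_column (matrix_to_deal n A) (Suc j) = mat_column A j"
      proof (rule deal_column_share)
        show "mat_column A j \<in> columns" using A(2) j by blast
        show "(e, Suc j) \<in> matrix_to_deal n A p \<longleftrightarrow> e \<in> share (mat_column A j) p" for e p
          using j unfolding matrix_to_deal_def by simp
      qed
    qed
    show "matrix_to_deal n A \<in> hanna_deals n"
      using deal_to_matrix_in_hanna_matrices_iff[OF color_avoiding_matrix_to_deal[OF A(2)]] that eq
        color_avoiding_matrix_to_deal[OF A(2)]
      unfolding hanna_deals_iff by (metis (no_types, lifting) mem_Collect_eq subsetI)
  qed
  have deal: "matrix_to_deal n (deal_to_matrix n H) = H" "deal_to_matrix n H \<in> hanna_matrices n"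
    if H: "H \<in> hanna_deals n" for H
  proof -
    obtain S where S: "S \<subseteq> {1..n}" "color_avoiding S H" "card (H Red) = card S"
      using H unfolding hanna_deals_iff by blast
    show "deal_to_matrix n H \<in> hanna_matrices n"
      using deal_to_matrix_in_hanna_matrices_iff[OF S(2,1)] S(3) by (rule iffD2)
    have "mat_column (deal_to_matrix n H) (d - 1) = deal_column H d" if "d \<in> {1..n}" for d
    proof -
      have "d - 1 < n" "Suc (d - 1) = d" using that by auto
      then show ?thesis
        unfolding deal_to_matrix_conv by (metis mat_column_mat_of_columns)
    qed
    then have "(c, d) \<in> matrix_to_deal n (deal_to_matrix n H) p \<longleftrightarrow>
        d \<in> {1..n} \<and> c \<in> share (deal_column H d) p" for c d p
      unfolding matrix_to_deal_def by auto
    then have "(c, d) \<in> matrix_to_deal n (deal_to_matrix n H) p \<longleftrightarrow> (c, d) \<in> H p" for c d p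
      using share_deal_column[OF S(2)] color_avoiding_cases(7)[OF S(2)] S(1) by blast
    then show "matrix_to_deal n (deal_to_matrix n H) = H"
      by (intro ext) auto
  qed
  show ?thesis
    using matrix deal by (intro bij_betw_byWitness[where f' = "matrix_to_deal n"]) auto
qed

theorem mainTheorem6:
  fixes n :: nat
  shows "hanna_matrices n \<approx> hanna_deals n \<and> hanna_deals n \<approx> hanna_paths n
    \<and> bij_betw matrix_to_path (hanna_matrices n) (hanna_paths n)
    \<and> bij_betw (deal_to_matrix n) (hanna_deals n) (hanna_matrices n)"
proof -
  have "hanna_deals n \<approx> hanna_matrices n" "hanna_matrices n \<approx> hanna_paths n"
    using deal_to_matrix_bij matrix_to_path_bij unfolding eqpoll_def by blast+
  then show ?thesis
    using deal_to_matrix_bij matrix_to_path_bij eqpoll_sym eqpoll_trans by blast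
qed

end
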